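(* Let $\mathcal{I},A,T,\{l^i\}_{i\in\mathcal{I}}$ be the players, actions, types and losses of a game with incomplete information, and let $b=(b_1,\dots,b_I)$, $b_i:T_i\to\Delta(T_{-i})$, be a (possibly inconsistent) system of interim beliefs. If $\beta\in NE^{int}_{\mathbb{G}}(\mathcal{R}_0,b)$, then there exist a fully supported common prior $P\in\Delta(T)$ and an ex ante risk preference profile $\bar{\mathcal{R}}=\{\bar\rho^1,\dots,\bar\rho^I\}$ assigning a coherent risk measure $\bar\rho^i$ to each player $i\in\mathcal{I}$, such that $\beta\in NE^{int}_{\mathbb{G}}(\bar{\mathcal{R}},P)$.
   Context: Game. $\mathcal{I}=\{1,\dots,I\}$, $I\ge2$, is a finite set of players. Each player $i$ has a non-empty finite set of types $T_i$ and a non-empty finite set of actions $A_i$; $T=\prod_i T_i$, $T_{-i}=\prod_{j\ne i}T_j$, $A=\prod_i A_i$. $\Delta(S)$ is the set of probability measures on a finite set $S$. $\mathcal{F}$ is the $\sigma$-algebra of all subsets of $T$. Player $i$ has a bounded loss function $l^i:T\times A\to\mathbb{R}$; players minimize losses. $\mathcal{F}^i_\tau\subset\mathcal{F}$ is the sub-$\sigma$-algebra generated by the cells $\{t\in T:\text{the } i\text{-th coordinate of } t\text{ is } t_i\}$, $t_i\in T_i$. Strategies. A (mixed/behavioral) strategy of player $i$ is a map $\beta_i:T_i\to\Delta(A_i)$; $\Sigma=\prod_i\Sigma_i$ is the set of strategy profiles. $(a_i,\beta_{-i})$ is the profile in which player $i$ plays the pure action $a_i\in A_i$ and the others play as in $\beta$.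 Random loss: $L^i_\beta(t)=L^i(t,\beta)=\sum_{a\in A}l^i(t,a)\prod_{j\in\mathcal{I}}\beta_j(a_j|t_j)$. Inconsistent beliefs. A system of interim beliefs $b$ is inconsistent if there is no common prior $P\in\Delta(T)$ such that each $b_i$ is conditionally derived from $P$. $NE^{int}_{\mathbb{G}}(\mathcal{R}_0,b)$: $\mathcal{R}_0$ is the degenerate profile assigning the expectation risk measure to every player, and $NE^{int}_{\mathbb{G}}(\mathcal{R}_0,b)$ is the set of Bayesian Nash equilibria of risk-neutral players with directly assigned beliefs $b$, i.e. of $\beta\in\Sigma$ such that for all $i\in\mathcal{I}$, $t_i\in T_i$, $a_i\in A_i$, $\sum_{t_{-i}}b_i(t_{-i}|t_i)L^i((t_i,t_{-i}),\beta)\le\sum_{t_{-i}}b_i(t_{-i}|t_i)L^i((t_i,t_{-i}),(a_i,\beta_{-i}))$, where $b_i(\cdot|t_i)$ denotes $b_i(t_i)\in\Delta(T_{-i})$. Coherent risk measure: $\rho:\mathcal{L}^\infty(T,\mathcal{F},P)\to\mathbb{R}$ satisfying monotonicity ($\rho(L_1)\le\rho(L_2)$ if $L_1\le L_2$ a.s.); convexity ($\rho((1-\alpha)L_1+\alpha L_2)\le(1-\alpha)\rho(L_1)+\alpha\rho(L_2)$, $0\le\alpha\le1$); translation invariance ($\rho(L+c)=\rho(L)+c$, $c\in\mathbb{R}$); positive homogeneity ($\rho(\alpha L)=\alpha\rho(L)$, $\alpha>0$). Conditional counterpart. For a coherent risk measure $\rho^i$ of player $i$ (with $\mathbb{E}$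 the expectation under the fully supported $P$), the conditional (unrevised interim) risk given $t_i$, defined with respect to the conditional distribution $P(\cdot|t_i)$, is $$\rho^i(L|t_i)=\sup\{\mathbb{E}(LZ'|t_i): Z'\ge0,\ \mathbb{E}(Z'|\mathcal{F}^i_\tau)=1,\ \mathbb{E}(L'Z')\le\rho^i(L')\ \forall L'\in\mathcal{L}^\infty(T,\mathcal{F},P)\},$$ the set of such $Z'$ being required to be nonempty. $NE^{int}_{\mathbb{G}}(\mathcal{R},P)$ is the set of risk-averse Bayesian Nash equilibria for $\mathcal{R}=\{\rho^1,\dots,\rho^I\}$ and prior $P$: $\beta\in\Sigma$ such that for all $i\in\mathcal{I}$, $t_i\in T_i$, $a_i\in A_i$, $\rho^i(L^i_\beta|t_i)\le\rho^i(L^i_{(a_i,\beta_{-i})}|t_i)$. *)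

theory Defs
  imports "HOL-Probability.Probability"
begin

text \<open>Type and action sets are carved out of common ambient types; a profile is an
  extensional function on the player set.\<close>

record ('t, 'a) game =
  num_players :: nat
  types :: "nat \<Rightarrow> 't set"
  actions :: "nat \<Rightarrow> 'a set"
  loss :: "nat \<Rightarrow> (nat \<Rightarrow> 't) \<Rightarrow> (nat \<Rightarrow> 'a) \<Rightarrow> real"

definition players :: "('t, 'a) game \<Rightarrow> nat set" where
  "players G = {1..num_players G}"

definition type_profiles :: "('t, 'a) game \<Rightarrow> (nat \<Rightarrow> 't) set" where
  "type_profiles G = PiE (players G) (types G)"

definition other_type_profiles :: "('t, 'a) game \<Rightarrow> nat \<Rightarrow> (nat \<Rightarrow> 't) set" where
  "other_type_profiles G i = PiE (players G - {i}) (types G)"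

definition action_profiles :: "('t, 'a) game \<Rightarrow> (nat \<Rightarrow> 'a) set" where
  "action_profiles G = PiE (players G) (actions G)"

definition incomplete_information_game :: "('t, 'a) game \<Rightarrow> bool" where
  "incomplete_information_game G \<longleftrightarrow>
     num_players G \<ge> 2 \<and>
     (\<forall>i\<in>players G.
        finite (types G i) \<and> types G i \<noteq> {} \<and>
        finite (actions G i) \<and> actions G i \<noteq> {} \<and>
        bounded ((\<lambda>(t, a). loss G i t a) ` (type_profiles G \<times> action_profiles G)))"

definition prob_on :: "'s set \<Rightarrow> 's pmf set" where
  "prob_on S = {p. set_pmf p \<subseteq> S}"

text \<open>Strategies and beliefs are not required to be extensional: their values outside the
  player and type sets are never used.\<close>

definition strategy_profiles :: "('t, 'a) game \<Rightarrow> (nat \<Rightarrow> 't \<Rightarrow> 'a pmf) set" where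
  "strategy_profiles G = (\<Pi> i\<in>players G. types G i \<rightarrow> prob_on (actions G i))"

definition belief_systems :: "('t, 'a) game \<Rightarrow> (nat \<Rightarrow> 't \<Rightarrow> (nat \<Rightarrow> 't) pmf) set" where
  "belief_systems G = (\<Pi> i\<in>players G. types G i \<rightarrow> prob_on (other_type_profiles G i))"

definition deviate :: "(nat \<Rightarrow> 't \<Rightarrow> 'a pmf) \<Rightarrow> nat \<Rightarrow> 'a \<Rightarrow> (nat \<Rightarrow> 't \<Rightarrow> 'a pmf)" where
  "deviate \<beta> i a\<^sub>i = \<beta>(i := \<lambda>_. return_pmf a\<^sub>i)"

definition random_loss ::
  "('t, 'a) game \<Rightarrow> nat \<Rightarrow> (nat \<Rightarrow> 't \<Rightarrow> 'a pmf) \<Rightarrow> (nat \<Rightarrow> 't) \<Rightarrow> real" where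
  "random_loss G i \<beta> t =
     (\<Sum>a\<in>action_profiles G. loss G i t a * (\<Prod>j\<in>players G. pmf (\<beta> j (t j)) (a j)))"

definition interim_expected_loss ::
  "('t, 'a) game \<Rightarrow> (nat \<Rightarrow> 't \<Rightarrow> (nat \<Rightarrow> 't) pmf) \<Rightarrow> nat \<Rightarrow> 't \<Rightarrow>
   (nat \<Rightarrow> 't \<Rightarrow> 'a pmf) \<Rightarrow> real" where
  "interim_expected_loss G b i t\<^sub>i \<beta> =
     (\<Sum>s\<in>other_type_profiles G i. pmf (b i t\<^sub>i) s * random_loss G i \<beta> (s(i := t\<^sub>i)))"

definition belief_NE ::
  "('t, 'a) game \<Rightarrow> (nat \<Rightarrow> 't \<Rightarrow> (nat \<Rightarrow> 't) pmf) \<Rightarrow> (nat \<Rightarrow> 't \<Rightarrow> 'a pmf) set" where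
  "belief_NE G b =
     {\<beta> \<in> strategy_profiles G.
        \<forall>i\<in>players G. \<forall>t\<^sub>i\<in>types G i. \<forall>a\<^sub>i\<in>actions G i.
          interim_expected_loss G b i t\<^sub>i \<beta> \<le> interim_expected_loss G b i t\<^sub>i (deviate \<beta> i a\<^sub>i)}"

text \<open>A prior is a pmf with finite support, so every real function is essentially bounded, and
  monotonicity makes \<open>\<rho>\<close> respect almost-sure equality.  A functional on all real functions is
  thus the same thing as one on the \<open>L\<close>-infinity space of the prior.\<close>

definition coherent_risk_measure :: "'s pmf \<Rightarrow> (('s \<Rightarrow> real) \<Rightarrow> real) \<Rightarrow> bool" where
  "coherent_risk_measure P \<rho> \<longleftrightarrow>
     (\<forall>L\<^sub>1 L\<^sub>2. (AE t in measure_pmf P. L\<^sub>1 t \<le> L\<^sub>2 t) \<longrightarrow> \<rho> L\<^sub>1 \<le> \<rho> L\<^sub>2) \<and>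
     (\<forall>L\<^sub>1 L\<^sub>2 \<alpha>. 0 \<le> \<alpha> \<and> \<alpha> \<le> 1 \<longrightarrow>
        \<rho> (\<lambda>t. (1 - \<alpha>) * L\<^sub>1 t + \<alpha> * L\<^sub>2 t) \<le> (1 - \<alpha>) * \<rho> L\<^sub>1 + \<alpha> * \<rho> L\<^sub>2) \<and>
     (\<forall>L c. \<rho> (\<lambda>t. L t + c) = \<rho> L + c) \<and>
     (\<forall>L \<alpha>. \<alpha> > 0 \<longrightarrow> \<rho> (\<lambda>t. \<alpha> * L t) = \<alpha> * \<rho> L)"

text \<open>The whole type \<open>nat \<Rightarrow> 't\<close> serves as the space, to make this a subalgebra of
  \<open>measure_pmf P\<close>; the complement of the type profiles is a null set.\<close>

definition type_algebra :: "('t, 'a) game \<Rightarrow> nat \<Rightarrow> (nat \<Rightarrow> 't) measure" where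
  "type_algebra G i = sigma UNIV ((\<lambda>t\<^sub>i. {t \<in> type_profiles G. t i = t\<^sub>i}) ` types G i)"

definition conditional_densities ::
  "('t, 'a) game \<Rightarrow> (nat \<Rightarrow> 't) pmf \<Rightarrow> nat \<Rightarrow> (((nat \<Rightarrow> 't) \<Rightarrow> real) \<Rightarrow> real) \<Rightarrow>
   ((nat \<Rightarrow> 't) \<Rightarrow> real) set" where
  "conditional_densities G P i \<rho> =
     {Z. (AE t in measure_pmf P. 0 \<le> Z t) \<and>
         (AE t in measure_pmf P. real_cond_exp (measure_pmf P) (type_algebra G i) Z t = 1) \<and>
         (\<forall>L. measure_pmf.expectation P (\<lambda>t. L t * Z t) \<le> \<rho> L)}"

definition conditional_risk ::
  "('t, 'a) game \<Rightarrow> (nat \<Rightarrow> 't) pmf \<Rightarrow> nat \<Rightarrow> (((nat \<Rightarrow> 't) \<Rightarrow> real) \<Rightarrow> real) \<Rightarrow>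
   't \<Rightarrow> ((nat \<Rightarrow> 't) \<Rightarrow> real) \<Rightarrow> real" where
  "conditional_risk G P i \<rho> t\<^sub>i L =
     (SUP Z\<in>conditional_densities G P i \<rho>.
        measure_pmf.expectation (cond_pmf P {t. t i = t\<^sub>i}) (\<lambda>t. L t * Z t))"

text \<open>Non-emptiness of the density sets is part of the equilibrium notion: otherwise the
  suprema would be unspecified.\<close>

definition risk_averse_NE ::
  "('t, 'a) game \<Rightarrow> (nat \<Rightarrow> ((nat \<Rightarrow> 't) \<Rightarrow> real) \<Rightarrow> real) \<Rightarrow> (nat \<Rightarrow> 't) pmf \<Rightarrow>
   (nat \<Rightarrow> 't \<Rightarrow> 'a pmf) set" where
  "risk_averse_NE G \<R> P =
     {\<beta> \<in> strategy_profiles G.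
        \<forall>i\<in>players G. conditional_densities G P i (\<R> i) \<noteq> {} \<and>
          (\<forall>t\<^sub>i\<in>types G i. \<forall>a\<^sub>i\<in>actions G i.
             conditional_risk G P i (\<R> i) t\<^sub>i (random_loss G i \<beta>)
             \<le> conditional_risk G P i (\<R> i) t\<^sub>i (random_loss G i (deviate \<beta> i a\<^sub>i)))}"

end

theory Submission
  imports Defs
begin

text \<open>Take the uniform prior \<open>P\<close> and let \<open>\<rho>\<^sup>i\<close> be the expectation under
  \<open>Q\<^sub>i(t) = b\<^sub>i(t\<^sub>-\<^sub>i | t\<^sub>i) / |T\<^sub>i|\<close>, whose density with respect to \<open>P\<close> is
  \<open>Z(t) = |T\<^sub>-\<^sub>i| b\<^sub>i(t\<^sub>-\<^sub>i | t\<^sub>i)\<close>.  As \<open>\<rho>\<^sup>i\<close> is linear, its dual set is the singleton \<open>{Z}\<close> up to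
  null sets, and \<open>Z\<close> has conditional expectation \<open>1\<close> because each \<open>b\<^sub>i(\<cdot> | t\<^sub>i)\<close> has total
  mass \<open>1\<close>.  Hence the conditional risk given \<open>t\<^sub>i\<close> is the expectation under \<open>b\<^sub>i(\<cdot> | t\<^sub>i)\<close>, and
  the two equilibrium conditions coincide.\<close>

text \<open>The functional is linear, so convexity and homogeneity hold with equality. Monotonicity
  comes from \<open>nonneg\<close>, translation invariance from \<open>mass\<close>; finite support
  makes everything integrable.\<close>

lemma coherent_risk_measure_expectation_density:
  assumes fin: "finite (set_pmf P)"
    and nonneg: "\<And>t. t \<in> set_pmf P \<Longrightarrow> 0 \<le> Z t"
    and mass: "measure_pmf.expectation P Z = 1"
  shows "coherent_risk_measure P (\<lambda>L. measure_pmf.expectation P (\<lambda>t. L t * Z t))"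
proof -
  note int = integrable_measure_pmf_finite[OF fin]
  show ?thesis
    unfolding coherent_risk_measure_def
  proof (intro conjI allI impI)
    fix L\<^sub>1 L\<^sub>2 :: "'a \<Rightarrow> real"
    assume "AE t in measure_pmf P. L\<^sub>1 t \<le> L\<^sub>2 t"
    then show "measure_pmf.expectation P (\<lambda>t. L\<^sub>1 t * Z t) \<le> measure_pmf.expectation P (\<lambda>t. L\<^sub>2 t * Z t)"
      by (intro integral_mono_AE int) (auto simp: AE_measure_pmf_iff nonneg intro: mult_right_mono)
  next
    fix L\<^sub>1 L\<^sub>2 :: "'a \<Rightarrow> real" and \<alpha> :: real
    have "(\<lambda>t. ((1 - \<alpha>) * L\<^sub>1 t + \<alpha> * L\<^sub>2 t) * Z t)
        = (\<lambda>t. (1 - \<alpha>) * (L\<^sub>1 t * Z t) + \<alpha> * (L\<^sub>2 t * Z t))"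
      by (simp add: algebra_simps)
    then show "measure_pmf.expectation P (\<lambda>t. ((1 - \<alpha>) * L\<^sub>1 t + \<alpha> * L\<^sub>2 t) * Z t)
      \<le> (1 - \<alpha>) * measure_pmf.expectation P (\<lambda>t. L\<^sub>1 t * Z t)
        + \<alpha> * measure_pmf.expectation P (\<lambda>t. L\<^sub>2 t * Z t)"
      by (simp add: int)
  next
    fix L :: "'a \<Rightarrow> real" and c :: real
    show "measure_pmf.expectation P (\<lambda>t. (L t + c) * Z t)
      = measure_pmf.expectation P (\<lambda>t. L t * Z t) + c"
      by (simp add: distrib_right int mass)
  next
    fix L :: "'a \<Rightarrow> real" and \<alpha> :: real
    show "measure_pmf.expectation P (\<lambda>t. \<alpha> * L t * Z t)
      = \<alpha> * measure_pmf.expectation P (\<lambda>t. L t * Z t)"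
      by (simp add: mult.assoc)
  qed
qed

text \<open>Testing with plus and minus the point indicator of \<open>t\<close> gives both
  inequalities, and the factor \<open>pmf P t > 0\<close> cancels. So the dual set of a linear
  functional has only one element, up to values off the support.\<close>

lemma density_eq_if_expectation_le:
  assumes "finite (set_pmf P)" and "t \<in> set_pmf P"
    and le: "\<And>L :: 'a \<Rightarrow> real.
      measure_pmf.expectation P (\<lambda>t. L t * W t) \<le> measure_pmf.expectation P (\<lambda>t. L t * Z t)"
  shows "W t = (Z t :: real)"
proof -
  have *: "measure_pmf.expectation P (\<lambda>u. (if u = t then c else 0) * V u) = pmf P t * (c * V t)"
    for c :: real and V
    using assms(1,2) by (subst integral_measure_pmf[of "{t}"]) (auto split: if_splits)
  show ?thesis
    using le[of "\<lambda>u. if u = t then 1 else 0"] le[of "\<lambda>u. if u = t then - 1 else 0"]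
      pmf_positive[OF assms(2)]
    unfolding * by simp
qed

text \<open>The inverse resets coordinate \<open>i\<close> to \<open>undefined\<close>, the value an
  extensional profile takes outside its domain.\<close>

lemma bij_betw_other_type_profiles:
  assumes "i \<in> players G" and "t\<^sub>i \<in> types G i"
  shows "bij_betw (\<lambda>s. s(i := t\<^sub>i)) (other_type_profiles G i) {t \<in> type_profiles G. t i = t\<^sub>i}"
proof (rule bij_betwI[where g = "\<lambda>t. t(i := undefined)"])
  show "(\<lambda>s. s(i := t\<^sub>i)) \<in> other_type_profiles G i \<rightarrow> {t \<in> type_profiles G. t i = t\<^sub>i}"
    using assms by (auto simp: other_type_profiles_def type_profiles_def PiE_iff extensional_def)
  show "(\<lambda>t. t(i := undefined)) \<in> {t \<in> type_profiles G. t i = t\<^sub>i} \<rightarrow> other_type_profiles G i"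
    by (auto simp: other_type_profiles_def type_profiles_def PiE_iff extensional_def)
qed (auto simp: other_type_profiles_def PiE_iff extensional_def fun_upd_idem_iff)

text \<open>The generating cells do not separate two such profiles, and this survives complements
  and countable unions. Both points must be type profiles, since the cells contain no
  others.\<close>

lemma type_algebra_saturated:
  assumes "A \<in> sets (type_algebra G i)"
    and "t \<in> type_profiles G" "u \<in> type_profiles G" "t i = u i"
  shows "t \<in> A \<longleftrightarrow> u \<in> A"
proof -
  have "A \<in> sigma_sets UNIV ((\<lambda>t\<^sub>i. {t \<in> type_profiles G. t i = t\<^sub>i}) ` types G i)"
    using assms(1) by (simp add: type_algebra_def)
  then show ?thesis
    by induction (use assms in auto)
qed

lemma subalgebra_type_algebra: "subalgebra (measure_pmf P) (type_algebra G i)"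
  by (simp add: subalgebra_def type_algebra_def)

text \<open>\<open>t(i := undefined)\<close> encodes the profile of the other players' types as an
  extensional function.\<close>

definition belief_density ::
  "('t, 'a) game \<Rightarrow> (nat \<Rightarrow> 't \<Rightarrow> (nat \<Rightarrow> 't) pmf) \<Rightarrow> nat \<Rightarrow> (nat \<Rightarrow> 't) \<Rightarrow> real" where
  "belief_density G b i t =
     real (card (other_type_profiles G i)) * pmf (b i (t i)) (t(i := undefined))"

locale game_with_beliefs =
  fixes G :: "('t, 'a) game" and b :: "nat \<Rightarrow> 't \<Rightarrow> (nat \<Rightarrow> 't) pmf"
  assumes game: "incomplete_information_game G" and beliefs: "b \<in> belief_systems G"
begin

lemma finite_players: "finite (players G)"
  by (simp add: players_def)

lemma finite_types: "i \<in> players G \<Longrightarrow> finite (types G i)"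
  and types_nonempty: "i \<in> players G \<Longrightarrow> types G i \<noteq> {}"
  using game by (auto simp: incomplete_information_game_def)

lemma finite_type_profiles: "finite (type_profiles G)"
  and type_profiles_nonempty: "type_profiles G \<noteq> {}"
  and finite_other_type_profiles: "finite (other_type_profiles G i)"
  and other_type_profiles_nonempty: "other_type_profiles G i \<noteq> {}"
  unfolding type_profiles_def other_type_profiles_def PiE_eq_empty_iff
  using finite_players finite_types types_nonempty by (blast intro: finite_PiE)+

lemma card_other_type_profiles_pos: "card (other_type_profiles G i) > 0"
  using finite_other_type_profiles other_type_profiles_nonempty by (simp add: card_gt_0_iff)

text \<open>Uniformity gives full support and makes all cells of a player equally likely, so one
  factor \<open>card (other_type_profiles G i)\<close> normalises the density on each of
  them.\<close>

definition prior :: "(nat \<Rightarrow> 't) pmf" where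
  "prior = pmf_of_set (type_profiles G)"

lemma set_pmf_prior: "set_pmf prior = type_profiles G"
  by (simp add: prior_def finite_type_profiles type_profiles_nonempty)

lemma expectation_prior:
  "measure_pmf.expectation prior f = (\<Sum>t\<in>type_profiles G. f t) / card (type_profiles G)"
  for f :: "(nat \<Rightarrow> 't) \<Rightarrow> real"
  by (simp add: prior_def integral_pmf_of_set finite_type_profiles type_profiles_nonempty)

lemma sum_belief:
  assumes "i \<in> players G" "t\<^sub>i \<in> types G i"
  shows "(\<Sum>s\<in>other_type_profiles G i. pmf (b i t\<^sub>i) s) = 1"
  using beliefs assms
  by (intro sum_pmf_eq_1 finite_other_type_profiles) (auto simp: belief_systems_def prob_on_def)

lemma belief_density_upd:
  "s \<in> other_type_profiles G i \<Longrightarrow>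
    belief_density G b i (s(i := t\<^sub>i)) = card (other_type_profiles G i) * pmf (b i t\<^sub>i) s"
  by (auto simp: belief_density_def other_type_profiles_def PiE_iff extensional_def fun_upd_idem)

text \<open>This reindexing turns sums over a cell into averages under the belief. It serves both to
  normalise the density and to evaluate the conditional risk.\<close>

lemma sum_cell_belief_density:
  assumes "i \<in> players G" "t\<^sub>i \<in> types G i"
  shows "(\<Sum>t | t \<in> type_profiles G \<and> t i = t\<^sub>i. f t * belief_density G b i t)
    = card (other_type_profiles G i) * (\<Sum>s\<in>other_type_profiles G i. pmf (b i t\<^sub>i) s * f (s(i := t\<^sub>i)))"
proof -
  have "(\<Sum>t | t \<in> type_profiles G \<and> t i = t\<^sub>i. f t * belief_density G b i t)
    = (\<Sum>s\<in>other_type_profiles G i. f (s(i := t\<^sub>i)) * belief_density G b i (s(i := t\<^sub>i)))"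
    by (rule sum.reindex_bij_betw[OF bij_betw_other_type_profiles[OF assms], symmetric])
  then show ?thesis
    by (simp add: sum_distrib_left belief_density_upd mult_ac)
qed

lemma card_cell:
  assumes "i \<in> players G" "t\<^sub>i \<in> types G i"
  shows "card {t \<in> type_profiles G. t i = t\<^sub>i} = card (other_type_profiles G i)"
  using bij_betw_same_card[OF bij_betw_other_type_profiles[OF assms]] by simp

text \<open>On a cell \<open>f\<close> is constant and the beliefs sum to 1, so the density
  contributes exactly the number of points in the cell. Indicators of sets in
  \<open>type_algebra G i\<close> give the conditional expectation, and \<open>f = 1\<close> gives
  the total mass.\<close>

lemma sum_saturated_belief_density:
  assumes i: "i \<in> players G"
    and sat: "\<And>t u. t \<in> type_profiles G \<Longrightarrow> u \<in> type_profiles G \<Longrightarrow> t i = u i \<Longrightarrow> f t = f u"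
  shows "(\<Sum>t\<in>type_profiles G. f t * belief_density G b i t) = (\<Sum>t\<in>type_profiles G. f t)"
proof -
  have coord: "(\<lambda>t. t i) ` type_profiles G \<subseteq> types G i"
    using i by (auto simp: type_profiles_def)
  note group = sum.group[OF finite_type_profiles finite_types[OF i] coord, symmetric]
  have "(\<Sum>t | t \<in> type_profiles G \<and> t i = t\<^sub>i. f t * belief_density G b i t)
      = (\<Sum>t | t \<in> type_profiles G \<and> t i = t\<^sub>i. f t)" if ti: "t\<^sub>i \<in> types G i" for t\<^sub>i
  proof -
    \<comment> \<open>An arbitrary representative, chosen only to name the constant value of
      \<open>f\<close> on the cell.\<close>
    obtain s\<^sub>0 where s0: "s\<^sub>0 \<in> other_type_profiles G i"
      using other_type_profiles_nonempty by blast
    let ?c = "f (s\<^sub>0(i := t\<^sub>i))"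
    have mem: "s(i := t\<^sub>i) \<in> type_profiles G" if "s \<in> other_type_profiles G i" for s
      using bij_betwE[OF bij_betw_other_type_profiles[OF i ti]] that by auto
    have "(\<Sum>s\<in>other_type_profiles G i. pmf (b i t\<^sub>i) s * f (s(i := t\<^sub>i)))
        = (\<Sum>s\<in>other_type_profiles G i. pmf (b i t\<^sub>i) s * ?c)"
      using mem s0 by (intro sum.cong refl arg_cong2[where f = "(*)"] sat) auto
    also have "\<dots> = ?c"
      by (simp add: sum_distrib_right[symmetric] sum_belief[OF i ti])
    finally have "(\<Sum>t | t \<in> type_profiles G \<and> t i = t\<^sub>i. f t * belief_density G b i t)
        = card (other_type_profiles G i) * ?c"
      by (simp add: sum_cell_belief_density[OF i ti])
    also have "\<dots> = (\<Sum>t | t \<in> type_profiles G \<and> t i = t\<^sub>i. ?c)"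
      by (simp add: card_cell[OF i ti])
    also have "\<dots> = (\<Sum>t | t \<in> type_profiles G \<and> t i = t\<^sub>i. f t)"
      using mem[OF s0] by (intro sum.cong refl sat) auto
    finally show ?thesis .
  qed
  then show ?thesis
    by (simp add: group)
qed

lemma cond_exp_belief_density:
  assumes "i \<in> players G"
  shows "AE t in measure_pmf prior.
    real_cond_exp (measure_pmf prior) (type_algebra G i) (belief_density G b i) t = 1"
proof -
  interpret finite_measure_subalgebra "measure_pmf prior" "type_algebra G i"
    by unfold_locales (rule subalgebra_type_algebra)
  have int: "integrable (measure_pmf prior) (f :: _ \<Rightarrow> real)" for f
    by (rule integrable_measure_pmf_finite) (simp add: set_pmf_prior finite_type_profiles)
  show ?thesis
  \<comment> \<open>The constant 1 is the candidate: it is measurable, so only its integrals over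
    sets of the subalgebra have to be compared with those of the density.\<close>
  proof (rule real_cond_exp_charact)
    fix A assume A: "A \<in> sets (type_algebra G i)"
    have "(\<Sum>t\<in>type_profiles G. indicat_real A t * belief_density G b i t)
        = (\<Sum>t\<in>type_profiles G. indicat_real A t)"
      by (intro sum_saturated_belief_density[OF assms])
        (metis (full_types) indicator_simps type_algebra_saturated[OF A])
    then show "(\<integral>t\<in>A. belief_density G b i t \<partial>measure_pmf prior) = (\<integral>t\<in>A. 1 \<partial>measure_pmf prior)"
      unfolding set_lebesgue_integral_def expectation_prior by simp
  qed (auto intro: int)
qed

definition belief_risk :: "nat \<Rightarrow> ((nat \<Rightarrow> 't) \<Rightarrow> real) \<Rightarrow> real" where
  "belief_risk i L = measure_pmf.expectation prior (\<lambda>t. L t * belief_density G b i t)"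

lemma coherent_belief_risk:
  assumes "i \<in> players G"
  shows "coherent_risk_measure prior (belief_risk i)"
  unfolding belief_risk_def
proof (rule coherent_risk_measure_expectation_density)
  show "measure_pmf.expectation prior (belief_density G b i) = 1"
    using sum_saturated_belief_density[OF assms, of "\<lambda>_. 1"] finite_type_profiles type_profiles_nonempty
    by (simp add: expectation_prior)
qed (simp_all add: set_pmf_prior finite_type_profiles belief_density_def)

lemma belief_density_mem_conditional_densities:
  "i \<in> players G \<Longrightarrow> belief_density G b i \<in> conditional_densities G prior i (belief_risk i)"
  by (simp add: conditional_densities_def cond_exp_belief_density belief_risk_def belief_density_def)

text \<open>Full support of \<open>prior\<close> turns uniqueness on the support into equality at
  every type profile.\<close>

lemma conditional_densities_eq_belief_density:
  assumes "Z \<in> conditional_densities G prior i (belief_risk i)" and "t \<in> type_profiles G"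
  shows "Z t = belief_density G b i t"
  using assms
  by (intro density_eq_if_expectation_le[of prior])
    (auto simp: conditional_densities_def belief_risk_def set_pmf_prior finite_type_profiles)

text \<open>Conditioning a uniform distribution on a cell gives the uniform distribution on that
  cell.\<close>

lemma expectation_cond_prior:
  fixes f :: "(nat \<Rightarrow> 't) \<Rightarrow> real"
  assumes "i \<in> players G" "t\<^sub>i \<in> types G i"
  shows "measure_pmf.expectation (cond_pmf prior {t. t i = t\<^sub>i}) f
    = (\<Sum>t | t \<in> type_profiles G \<and> t i = t\<^sub>i. f t) / card (other_type_profiles G i)"
proof -
  let ?C = "{t \<in> type_profiles G. t i = t\<^sub>i}"
  have C: "type_profiles G \<inter> {t. t i = t\<^sub>i} = ?C" by blast
  \<comment> \<open>\<open>cond_pmf\<close> is determined only when the conditioning event meets the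
    support.\<close>
  have ne: "?C \<noteq> {}"
    using card_cell[OF assms] card_other_type_profiles_pos[of i] by (metis card.empty less_irrefl)
  have inter: "set_pmf prior \<inter> {t. t i = t\<^sub>i} \<noteq> {}"
    unfolding set_pmf_prior C by (rule ne)
  have "pmf (cond_pmf prior {t. t i = t\<^sub>i}) t = pmf (pmf_of_set ?C) t" for t
    unfolding pmf_cond[OF inter] using ne finite_type_profiles type_profiles_nonempty
    by (simp add: prior_def measure_pmf_of_set C indicator_def)
  then have "cond_pmf prior {t. t i = t\<^sub>i} = pmf_of_set ?C"
    by (rule pmf_eqI)
  then show ?thesis
    using ne by (simp add: integral_pmf_of_set finite_type_profiles card_cell[OF assms])
qed

text \<open>Every admissible density yields the same expectation, with the cell size cancelling, so
  the supremum runs over a constant.\<close>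

lemma conditional_risk_belief_risk:
  assumes "i \<in> players G" "t\<^sub>i \<in> types G i"
  shows "conditional_risk G prior i (belief_risk i) t\<^sub>i L
    = (\<Sum>s\<in>other_type_profiles G i. pmf (b i t\<^sub>i) s * L (s(i := t\<^sub>i)))" (is "_ = ?r")
proof -
  have "measure_pmf.expectation (cond_pmf prior {t. t i = t\<^sub>i}) (\<lambda>t. L t * Z t) = ?r"
    if "Z \<in> conditional_densities G prior i (belief_risk i)" for Z
    using card_other_type_profiles_pos[of i]
    by (simp add: expectation_cond_prior[OF assms] conditional_densities_eq_belief_density[OF that]
        sum_cell_belief_density[OF assms])
  then have "conditional_risk G prior i (belief_risk i) t\<^sub>i L
      = (SUP Z\<in>conditional_densities G prior i (belief_risk i). ?r)"
    unfolding conditional_risk_def by (intro SUP_cong refl)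
  \<comment> \<open>The supremum of a constant has this value only over a non-empty index set; the
    belief density is a witness.\<close>
  also have "\<dots> = ?r"
    using belief_density_mem_conditional_densities[OF assms(1)] by (intro cSUP_const) auto
  finally show ?thesis .
qed

text \<open>Once conditional risks are rewritten as belief averages, the two families of
  inequalities are identical; the required non-emptiness again comes from the belief
  density.\<close>

lemma belief_NE_imp_risk_averse_NE:
  assumes "\<beta> \<in> belief_NE G b"
  shows "\<beta> \<in> risk_averse_NE G belief_risk prior"
  using assms
  by (auto simp: belief_NE_def risk_averse_NE_def conditional_risk_belief_risk
      interim_expected_loss_def dest: belief_density_mem_conditional_densities)

end

theorem theorem5:
  fixes G :: "('t, 'a) game"
    and b :: "nat \<Rightarrow> 't \<Rightarrow> (nat \<Rightarrow> 't) pmf"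
    and \<beta> :: "nat \<Rightarrow> 't \<Rightarrow> 'a pmf"
  assumes "incomplete_information_game G"
    and "b \<in> belief_systems G"
    and "\<beta> \<in> belief_NE G b"
  shows "\<exists>P \<R>. P \<in> prob_on (type_profiles G) \<and>
           (\<forall>t\<in>type_profiles G. pmf P t > 0) \<and>
           (\<forall>i\<in>players G. coherent_risk_measure P (\<R> i)) \<and>
           \<beta> \<in> risk_averse_NE G \<R> P"
proof -
  interpret game_with_beliefs G b
    by unfold_locales (fact assms)+
  show ?thesis
  proof (intro exI conjI ballI)
    show "prior \<in> prob_on (type_profiles G)"
      by (simp add: prob_on_def set_pmf_prior)
    show "pmf prior t > 0" if "t \<in> type_profiles G" for t
      using that by (intro pmf_positive) (simp add: set_pmf_prior)
    show "coherent_risk_measure prior (belief_risk i)" if "i \<in> players G" for i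
      by (rule coherent_belief_risk[OF that])
    show "\<beta> \<in> risk_averse_NE G belief_risk prior"
      by (rule belief_NE_imp_risk_averse_NE[OF assms(3)])
  qed
qed

end
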